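(* Let $f,g\in\mathbb R[x]$ be non-constant and let $a\in\mathbb R$ not be a common root of $f$ and $g$. Then $q(S_{f,g}(a))=V_{f,g}(a)$.
   Context: Sturm chain of $(f,g)$: set $f_0=f$, $f_1=g$, and define polynomials $f_2,\ldots,f_m$ and $d_1,\ldots,d_m$ by $f_{i-1}=d_if_i-f_{i+1}$ with $f_{i+1}\neq 0$ and $\deg f_{i+1}<\deg f_i$ for $1\leqslant i\leqslant m-1$, and $f_{m-1}=d_mf_m$. The Sturm matrix $S_{f,g}(x)$ is the $m\times m$ symmetric tridiagonal matrix with diagonal entries $d_1(x),\ldots,d_m(x)$, entries $1$ on the sub- and super-diagonals, and $0$ elsewhere. For a real symmetric matrix $M$, $q(M)$ is its negative index of inertia (number of negative eigenvalues counted with multiplicity). For real numbers $c_1,\ldots,c_n$, $\sigma(c_1,\ldots,c_n)$ is the number of sign variations: delete all zeros to get $c_{i_1},\ldots,c_{i_k}$ and count the indices $j$ with $c_{i_j}c_{i_{j+1}}<0$. Finally $V_{f,g}(x)=\sigma(f_0(x),\ldots,f_m(x))$. *)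

theory Defs
  imports "Jordan_Normal_Form.Char_Poly" "HOL-Computational_Algebra.Polynomial"
begin

text \<open>Only \<open>F 0, \<dots>, F m\<close> and \<open>D 1, \<dots>, D m\<close> are relevant: they are the polynomials
  $f_0,\ldots,f_m$ and $d_1,\ldots,d_m$.\<close>

definition sturm_chain ::
  "real poly \<Rightarrow> real poly \<Rightarrow> nat \<Rightarrow> (nat \<Rightarrow> real poly) \<Rightarrow> (nat \<Rightarrow> real poly) \<Rightarrow> bool" where
  "sturm_chain f g m F D \<longleftrightarrow>
     1 \<le> m \<and> F 0 = f \<and> F 1 = g \<and>
     (\<forall>i. 1 \<le> i \<and> i \<le> m - 1 \<longrightarrow>
        F (i - 1) = D i * F i - F (i + 1) \<and> F (i + 1) \<noteq> 0 \<and> degree (F (i + 1)) < degree (F i)) \<and>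
     F (m - 1) = D m * F m"

text \<open>Matrix indices start at 0, so the diagonal entry in row \<open>i\<close> is $d_{i+1}(x)$.\<close>

definition sturm_matrix :: "nat \<Rightarrow> (nat \<Rightarrow> real poly) \<Rightarrow> real \<Rightarrow> real mat" where
  "sturm_matrix m D x = mat m m (\<lambda>(i, j).
     if i = j then poly (D (i + 1)) x
     else if i = j + 1 \<or> j = i + 1 then 1
     else 0)"

definition neg_index :: "real mat \<Rightarrow> nat" where
  "neg_index M = (\<Sum>k | eigenvalue M k \<and> k < 0. order k (char_poly M))"

definition sign_variations :: "real list \<Rightarrow> nat" where
  "sign_variations cs = (let ds = filter (\<lambda>c. c \<noteq> 0) cs in
     card {j. j + 1 < length ds \<and> ds ! j * ds ! (j + 1) < 0})"

definition sturm_variations :: "nat \<Rightarrow> (nat \<Rightarrow> real poly) \<Rightarrow> real \<Rightarrow> nat" where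
  "sturm_variations m F x = sign_variations (map (\<lambda>i. poly (F i) x) [0..<m + 1])"

text \<open>The chain of \<open>(f, g)\<close> exists and is unique, so the Sturm matrix and the number of sign
  variations depend only on \<open>f\<close>, \<open>g\<close> and the point.\<close>

lemma sturm_chain_step:
  assumes "sturm_chain f g m F D" "1 \<le> i" "i < m"
  shows "F (i - 1) = D i * F i - F (i + 1)" "F (i + 1) \<noteq> 0" "degree (F (i + 1)) < degree (F i)"
proof -
  have "1 \<le> i \<and> i \<le> m - 1" using assms(2,3) by linarith
  then show "F (i - 1) = D i * F i - F (i + 1)" "F (i + 1) \<noteq> 0" "degree (F (i + 1)) < degree (F i)"
    using assms(1) unfolding sturm_chain_def by blast+
qed

lemma sturm_chain_ends:
  assumes "sturm_chain f g m F D"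
  shows "1 \<le> m" "F 0 = f" "F 1 = g" "F (m - 1) = D m * F m"
  using assms unfolding sturm_chain_def by blast+

lemma sturm_chainI:
  assumes "1 \<le> m" "F 0 = f" "F 1 = g" "F (m - 1) = D m * F m"
    and "\<And>i. 1 \<le> i \<Longrightarrow> i \<le> m - 1 \<Longrightarrow> F (i - 1) = D i * F i - F (i + 1) \<and> F (i + 1) \<noteq> 0 \<and>
      degree (F (i + 1)) < degree (F i)"
  shows "sturm_chain f g m F D"
  using assms unfolding sturm_chain_def by blast

lemma sturm_chain_exists:
  assumes "g \<noteq> 0"
  shows "\<exists>m F D. sturm_chain f g m F D"
  using assms
proof (induction "if g = 0 then 0 else Suc (degree g)" arbitrary: f g rule: less_induct)
  case less
  show ?case
  proof (cases "g dvd f")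
    case True
    then obtain d where "f = d * g" by (metis dvd_div_mult_self)
    then have "sturm_chain f g 1 (\<lambda>i. if i = 0 then f else g) (\<lambda>_. d)"
      by (simp add: sturm_chain_def)
    then show ?thesis by blast
  next
    case False
    define r where "r = - (f mod g)"
    have r0: "r \<noteq> 0" using False by (simp add: r_def dvd_eq_mod_eq_0)
    have dr: "degree r < degree g"
      using degree_mod_less[of g f] less.prems r0 by (auto simp: r_def)
    obtain m F D where c: "sturm_chain g r m F D"
      using less.hyps[of r g] r0 dr less.prems by auto
    define F' where "F' i = (if i = 0 then f else F (i - 1))" for i
    define D' where "D' i = (if i = 1 then f div g else D (i - 1))" for i
    have step: "F' (i - 1) = D' i * F' i - F' (i + 1) \<and> F' (i + 1) \<noteq> 0 \<and>
        degree (F' (i + 1)) < degree (F' i)" if i: "1 \<le> i" "i \<le> m" for i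
    proof (cases "i = 1")
      case True
      then show ?thesis
        using sturm_chain_ends(2,3)[OF c] r0 dr div_mult_mod_eq[of f g]
        by (simp add: F'_def D'_def r_def)
    next
      case False
      then obtain j where j: "i = Suc j" "1 \<le> j" "j < m"
        using i by (cases i) auto
      show ?thesis using sturm_chain_step[OF c j(2,3)] j(1,2) by (simp add: F'_def D'_def)
    qed
    have "sturm_chain f g (Suc m) F' D'"
    proof (rule sturm_chainI)
      show "F' (Suc m - 1) = D' (Suc m) * F' (Suc m)"
        using sturm_chain_ends(1,4)[OF c] by (simp add: F'_def D'_def)
    qed (use step sturm_chain_ends(2)[OF c] in \<open>simp_all add: F'_def\<close>)
    then show ?thesis by blast
  qed
qed

lemma sturm_chain_tail:
  assumes "sturm_chain f g m F D" "m \<noteq> 1"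
  shows "D 1 = f div g" "F 2 = - (f mod g)" "F 2 \<noteq> 0"
    "sturm_chain g (F 2) (m - 1) (\<lambda>i. F (Suc i)) (\<lambda>i. D (Suc i))"
proof -
  have m: "2 \<le> m" using assms sturm_chain_ends(1)[OF assms(1)] by linarith
  have h: "f = D 1 * g - F 2" "F 2 \<noteq> 0" "degree (F 2) < degree g"
    using sturm_chain_step[OF assms(1), of 1] sturm_chain_ends(2,3)[OF assms(1)] m
    by (simp_all add: numeral_2_eq_2)
  have g0: "g \<noteq> 0" using h(3) by auto
  have f: "f = - F 2 + D 1 * g" using h(1) by simp
  have "f div g = D 1 + (- F 2) div g" unfolding f using g0 by (rule div_mult_self1)
  then show "D 1 = f div g" using h(3) by (simp add: div_poly_less)
  have "f mod g = (- F 2) mod g" unfolding f by (rule mod_mult_self1)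
  then show "F 2 = - (f mod g)" using h(3) by (simp add: mod_poly_less)
  show "F 2 \<noteq> 0" by fact
  show "sturm_chain g (F 2) (m - 1) (\<lambda>i. F (Suc i)) (\<lambda>i. D (Suc i))"
  proof (rule sturm_chainI)
    show "F (Suc (m - 1 - 1)) = D (Suc (m - 1)) * F (Suc (m - 1))"
      using sturm_chain_ends(4)[OF assms(1)] m by (simp add: Suc_diff_Suc numeral_2_eq_2)
    show "F (Suc (i - 1)) = D (Suc i) * F (Suc i) - F (Suc (i + 1)) \<and> F (Suc (i + 1)) \<noteq> 0 \<and>
        degree (F (Suc (i + 1))) < degree (F (Suc i))" if "1 \<le> i" "i \<le> m - 1 - 1" for i
      using sturm_chain_step[OF assms(1), of "Suc i"] that m by simp
  qed (use sturm_chain_ends(3)[OF assms(1)] m in \<open>simp_all add: numeral_2_eq_2\<close>)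
qed

lemma sturm_chain_unique:
  assumes "g \<noteq> 0" "sturm_chain f g m F D" "sturm_chain f g m' F' D'"
  shows "m = m' \<and> (\<forall>i\<le>m. F i = F' i) \<and> (\<forall>i. 1 \<le> i \<and> i \<le> m \<longrightarrow> D i = D' i)"
  using assms
proof (induction m arbitrary: f g m' F D F' D')
  case 0
  then show ?case by (simp add: sturm_chain_def)
next
  case (Suc m)
  have ends: "f mod g = 0" "D 1 = f div g" if "sturm_chain f g 1 F D" for F D
    using sturm_chain_ends[OF that] Suc.prems(1) by auto
  have F01: "F 0 = F' 0" "F 1 = F' 1" "m' \<ge> 1"
    using sturm_chain_ends[OF Suc.prems(2)] sturm_chain_ends[OF Suc.prems(3)] by simp_all
  show ?case
  proof (cases "m = 0")
    case True
    then have c: "sturm_chain f g 1 F D" using Suc.prems by simp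
    have "m' = 1" using sturm_chain_tail[OF Suc.prems(3)] ends[OF c] by force
    then show ?thesis
      using True ends(2)[OF c] ends(2)[of F' D'] Suc.prems(3) F01
      by (auto simp: le_Suc_eq)
  next
    case False
    then have "Suc m \<noteq> 1" by simp
    note t = sturm_chain_tail[OF Suc.prems(2) this]
    have m': "m' \<noteq> 1" using ends(1)[of F' D'] Suc.prems(3) t(2,3) by force
    note t' = sturm_chain_tail[OF Suc.prems(3) m']
    have IH: "m = m' - 1 \<and> (\<forall>i\<le>m. F (Suc i) = F' (Suc i)) \<and>
        (\<forall>i. 1 \<le> i \<and> i \<le> m \<longrightarrow> D (Suc i) = D' (Suc i))"
    proof (rule Suc.IH)
      show "F 2 \<noteq> 0" by (rule t(3))
      show "sturm_chain g (F 2) m (\<lambda>i. F (Suc i)) (\<lambda>i. D (Suc i))" using t(4) by simp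
      have "F 2 = F' 2" using t(2) t'(2) by simp
      then show "sturm_chain g (F 2) (m' - 1) (\<lambda>i. F' (Suc i)) (\<lambda>i. D' (Suc i))"
        using t'(4) by simp
    qed
    have "F i = F' i" if "i \<le> Suc m" for i
      using IH F01 that by (cases i) auto
    moreover have "D i = D' i" if i: "1 \<le> i" "i \<le> Suc m" for i
    proof (cases "i = 1")
      case True
      then show ?thesis using t(1) t'(1) by simp
    next
      case False
      then obtain j where "i = Suc j" "1 \<le> j" using i by (cases i) auto
      then show ?thesis using IH i by auto
    qed
    ultimately show ?thesis using IH F01 by auto
  qed
qed

end

theory Submission
  imports Defs
begin

text \<open>Up to sign and the common factor $f_m(a) \neq 0$, the value $f_i(a)$ is the value at 0 of the
  characteristic polynomial $p_{m-i}$ of the trailing principal submatrix of order $m - i$ of the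
  Sturm matrix. These polynomials satisfy $p_{k+1} = (X - d)p_k - p_{k-1}$ for suitable \<open>d\<close>, so
  each has simple real roots, strictly interlaced by those of its predecessor. Hence $p_{k+1}$ has
  either as many negative roots as $p_k$ or one more, and which of the two occurs can be read off
  the signs at 0.\<close>

section \<open>Monic real polynomials with prescribed roots\<close>

definition linear_prod :: "nat \<Rightarrow> (nat \<Rightarrow> real) \<Rightarrow> real poly" where
  "linear_prod n r = (\<Prod>i<n. [:- r i, 1:])"

lemma poly_linear_prod: "poly (linear_prod n r) x = (\<Prod>i<n. x - r i)"
  by (simp add: linear_prod_def poly_prod)

lemma poly_linear_prod_eq_0_iff: "poly (linear_prod n r) x = 0 \<longleftrightarrow> (\<exists>i<n. x = r i)"
  by (auto simp: poly_linear_prod)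

lemma degree_linear_prod [simp]: "degree (linear_prod n r) = n"
  by (simp add: linear_prod_def degree_prod_sum_eq)

lemma lead_coeff_linear_prod: "lead_coeff (linear_prod n r) = 1"
  by (simp only: linear_prod_def lead_coeff_prod) simp

lemma coeff_linear_prod [simp]: "poly.coeff (linear_prod n r) n = 1"
  using lead_coeff_linear_prod[of n r] by simp

lemma linear_prod_neq_0 [simp]: "linear_prod n r \<noteq> 0"
  using coeff_linear_prod[of n r] by (metis coeff_0 zero_neq_one)

text \<open>The factors with index at least \<open>i\<close> are exactly the negative ones, and
  there are \<open>n - i\<close> of them.\<close>

lemma sign_poly_linear_prod:
  assumes "i \<le> n" "\<And>j. j < i \<Longrightarrow> r j < x" "\<And>j. i \<le> j \<Longrightarrow> j < n \<Longrightarrow> x < r j"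
  shows "0 < (-1) ^ (n - i) * poly (linear_prod n r) x"
  using assms(1) assms(3)
proof (induction n rule: dec_induct)
  case base
  show ?case using assms(2) by (auto simp: poly_linear_prod intro!: prod_pos)
next
  case (step n)
  have "0 < (-1) ^ (n - i) * poly (linear_prod n r) x" using step.prems by (intro step.IH) auto
  moreover have "0 < r n - x" using step by auto
  ultimately have "0 < (-1) ^ (n - i) * poly (linear_prod n r) x * (r n - x)" by (rule mult_pos_pos)
  then show ?case using step.hyps by (simp add: poly_linear_prod Suc_diff_le algebra_simps)
qed

text \<open>Both sides are monic of degree \<open>n\<close> and agree at \<open>n\<close> distinct
  points, while their difference has no term of degree \<open>n\<close>.\<close>

lemma monic_eq_linear_prod:
  assumes "degree u = n" "lead_coeff u = 1" "inj_on r {..<n}" "\<And>i. i < n \<Longrightarrow> poly u (r i) = 0"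
  shows "u = linear_prod n r"
proof (rule poly_eqI_degree_lead_coeff)
  show "poly.coeff u n = poly.coeff (linear_prod n r) n" using assms by simp
  show "card (r ` {..<n}) \<ge> n" using assms(3) by (simp add: card_image)
  show "poly u z = poly (linear_prod n r) z" if "z \<in> r ` {..<n}" for z
    using that assms(4) poly_linear_prod_eq_0_iff[of n r z] by auto
qed (use assms in auto)

lemma order_linear_prod:
  assumes "inj_on r {..<n}" "i < n"
  shows "order (r i) (linear_prod n r) = 1"
proof -
  define q where "q = (\<Prod>j\<in>{..<n} - {i}. [:- r j, 1:])"
  have eq: "linear_prod n r = [:- r i, 1:] * q"
    unfolding linear_prod_def q_def using assms(2) by (simp add: prod.remove)
  have "poly q (r i) \<noteq> 0"
    using assms by (auto simp: q_def poly_prod inj_on_def)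
  then have "order (r i) q = 0" by (simp add: order_0I)
  moreover have "order (r i) [:- r i, 1:] = 1" using order_power_n_n[of "r i" 1] by simp
  ultimately show ?thesis
    using linear_prod_neq_0[of n r] order_mult[of "[:- r i, 1:]" q "r i"] unfolding eq by simp
qed

lemma monic_pos_right:
  fixes u :: "real poly"
  assumes "lead_coeff u = 1"
  shows "\<exists>y>b. 0 < poly u y"
proof -
  obtain z where z: "\<And>x. x \<ge> z \<Longrightarrow> poly u x \<ge> lead_coeff u"
    using poly_pinfty_gt_lc[of u] assms by auto
  show ?thesis using z[of "max z (b + 1)"] assms by (intro exI[of _ "max z (b + 1)"]) auto
qed

text \<open>Substituting \<open>-X\<close> and multiplying by \<open>(-1) ^ degree u\<close> gives a
  monic polynomial again, so its positivity far to the right suffices.\<close>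

lemma monic_sign_left:
  fixes u :: "real poly"
  assumes "lead_coeff u = 1"
  shows "\<exists>y<b. 0 < (-1) ^ degree u * poly u y"
proof -
  define w where "w = Polynomial.smult ((-1) ^ degree u) (pcompose u [:0, -1:])"
  have "lead_coeff (pcompose u [:0, -1:]) = (-1) ^ degree u"
    using lead_coeff_comp[of "[:0, -1:]" u] assms by simp
  then have "lead_coeff w = 1" by (simp add: w_def flip: power_add)
  from monic_pos_right[OF this, of "- b"] obtain y where "- b < y" "0 < poly w y" by auto
  then show ?thesis by (intro exI[of _ "- y"]) (auto simp: w_def poly_pcompose)
qed

section \<open>Strictly interlacing families of reals\<close>

lemma less_chain_on:
  fixes r :: "nat \<Rightarrow> 'a::order"
  assumes "\<And>i. Suc i < n \<Longrightarrow> r i < r (Suc i)" "i < j" "j < n"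
  shows "r i < r j"
  using assms(2,3)
proof (induction j)
  case (Suc j)
  have "r j < r (Suc j)" using assms(1) Suc.prems by blast
  moreover have "i = j \<or> r i < r j" using Suc by (metis Suc_lessD less_SucE)
  ultimately show ?case using less_trans by blast
qed simp

lemma less_chain_inj_on:
  fixes r :: "nat \<Rightarrow> 'a::order"
  assumes "\<And>i. Suc i < n \<Longrightarrow> r i < r (Suc i)"
  shows "inj_on r {..<n}"
  using less_chain_on[of n r, OF assms]
  by (intro linorder_inj_onI) (auto dest: less_imp_neq)

text \<open>\<open>r\<close> contributes \<open>n + 1\<close> entries and \<open>s\<close> only
  \<open>n\<close>. The inequalities force both families to increase strictly on these index
  ranges.\<close>

definition interlacing :: "nat \<Rightarrow> (nat \<Rightarrow> real) \<Rightarrow> (nat \<Rightarrow> real) \<Rightarrow> bool" where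
  "interlacing n r s \<longleftrightarrow> (\<forall>i<n. r i < s i \<and> s i < r (Suc i))"

lemma interlacing_mono:
  assumes "interlacing n r s"
  shows "i < j \<Longrightarrow> j \<le> n \<Longrightarrow> r i < r j" "i < j \<Longrightarrow> j < n \<Longrightarrow> s i < s j"
    "i < j \<Longrightarrow> j \<le> n \<Longrightarrow> s i < r j" "i \<le> j \<Longrightarrow> j < n \<Longrightarrow> r i < s j"
    "inj_on r {..<Suc n}" "inj_on s {..<n}"
proof -
  have rs: "r i < s i" "s i < r (Suc i)" if "i < n" for i
    using assms that unfolding interlacing_def by blast+
  have r_step: "r i < r (Suc i)" if "Suc i < Suc n" for i using rs[of i] that by simp
  have s_step: "s i < s (Suc i)" if "Suc i < n" for i using rs[of i] rs[of "Suc i"] that by simp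
  show r: "r i < r j" if "i < j" "j \<le> n" for i j
    using less_chain_on[of "Suc n" r i j, OF r_step] that by simp
  show s: "s i < s j" if "i < j" "j < n" for i j
    using less_chain_on[of n s i j, OF s_step] that by simp
  show "s i < r j" if "i < j" "j \<le> n"
    using r[of "Suc i" j] rs(2)[of i] that by (cases "Suc i = j") auto
  show "r i < s j" if "i \<le> j" "j < n"
    using r[of i j] rs(1)[of j] that by (cases "i = j") auto
  show "inj_on r {..<Suc n}" "inj_on s {..<n}"
    using less_chain_inj_on r_step s_step by blast+
qed

text \<open>The value of $u = (X - c)p - q$ at a root of \<open>p\<close> is $-q$, whose sign alternates along the
  roots of \<open>p\<close>; the remaining two roots of \<open>u\<close> come from its behaviour at infinity.\<close>

lemma interlacing_step:
  fixes r s :: "nat \<Rightarrow> real" and c :: real and n :: nat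
  defines "u \<equiv> [:- c, 1:] * linear_prod (Suc n) r - linear_prod n s"
  assumes "interlacing n r s"
  shows "\<exists>t. u = linear_prod (Suc (Suc n)) t \<and> interlacing (Suc n) t r"
proof -
  define N where "N = Suc (Suc n)"
  note inter = interlacing_mono[OF assms(2)]
  have deg_main: "degree ([:- c, 1:] * linear_prod (Suc n) r) = N"
    by (subst degree_mult_eq) (auto simp: N_def)
  have deg: "degree u = N"
  proof -
    have "degree (- linear_prod n s) < degree ([:- c, 1:] * linear_prod (Suc n) r)"
      unfolding deg_main by (simp add: N_def)
    from degree_add_eq_left[OF this] deg_main show ?thesis unfolding u_def by simp
  qed
  have lc: "lead_coeff u = 1"
  proof -
    have "poly.coeff (linear_prod n s) N = 0" by (rule coeff_eq_0) (simp add: N_def)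
    moreover have "poly.coeff ([:- c, 1:] * linear_prod (Suc n) r) N = 1"
      using lead_coeff_mult[of "[:- c, 1:]" "linear_prod (Suc n) r"] deg_main
      by (simp only: lead_coeff_linear_prod) simp
    ultimately show ?thesis unfolding deg by (simp add: u_def)
  qed
  have sign_r: "0 < (-1) ^ (Suc n - i) * poly u (r i)" if i: "i \<le> n" for i
  proof -
    have "0 < (-1) ^ (n - i) * poly (linear_prod n s) (r i)"
    proof (rule sign_poly_linear_prod[OF i])
      show "s j < r i" if "j < i" for j
        using inter(3) that i by blast
      show "r i < s j" if "i \<le> j" "j < n" for j
        using inter(4) that by blast
    qed
    moreover have "poly (linear_prod (Suc n) r) (r i) = 0"
      unfolding poly_linear_prod_eq_0_iff using i le_imp_less_Suc by blast
    ultimately show ?thesis using i by (simp add: u_def Suc_diff_le)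
  qed
  obtain lo where lo: "lo < r 0" "0 < (-1) ^ N * poly u lo"
    using monic_sign_left[OF lc, of "r 0"] deg by auto
  obtain hi where hi: "r n < hi" "0 < poly u hi"
    using monic_pos_right[OF lc, of "r n"] by auto
  \<comment> \<open>The \<open>N + 1\<close> sample points are the \<open>r i\<close> together with
    one point on either side. The sign of \<open>u\<close> alternates along them, so each of the
    \<open>N\<close> gaps contains a root.\<close>
  define y where "y i = (if i = 0 then lo else if i = N then hi else r (i - 1))" for i
  have y_Suc: "y (Suc i) = r i" if "i \<le> n" for i using that by (simp add: y_def N_def)
  have y_less: "y i < y (Suc i)" if "i < N" for i
    using that lo hi inter(1)[of "i - 1" i] by (auto simp: y_def N_def less_Suc_eq)
  have sign_y: "0 < (-1) ^ (N - i) * poly u (y i)" if i: "i \<le> N" for i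
  proof -
    consider "i = 0" | "i = N" | j where "i = Suc j" "j \<le> n"
      using i unfolding N_def by (cases i) (auto simp: le_Suc_eq)
    then show ?thesis
    proof cases
      case 3
      then show ?thesis using sign_r[of j] by (simp add: y_Suc N_def)
    qed (use lo hi in \<open>auto simp: y_def N_def\<close>)
  qed
  have "\<exists>x>y i. x < y (Suc i) \<and> poly u x = 0" if "i < N" for i
  proof (rule poly_IVT[OF y_less[OF that]])
    have "N - i = Suc (N - Suc i)" using that by simp
    then have "0 < - ((-1) ^ (N - Suc i) * poly u (y i))"
      using sign_y[of i] that by simp
    moreover have "0 < (-1) ^ (N - Suc i) * poly u (y (Suc i))"
      using sign_y[of "Suc i"] that by simp
    ultimately have "0 < - ((-1) ^ (N - Suc i) * poly u (y i)) *
        ((-1) ^ (N - Suc i) * poly u (y (Suc i)))" by (rule mult_pos_pos)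
    also have "\<dots> = - (poly u (y i) * poly u (y (Suc i))) * ((-1) ^ (N - Suc i))\<^sup>2"
      by (simp add: power2_eq_square algebra_simps)
    also have "((-1::real) ^ (N - Suc i))\<^sup>2 = 1" by (simp flip: power_mult)
    finally show "poly u (y i) * poly u (y (Suc i)) < 0" by simp
  qed
  then obtain t where t: "\<And>i. i < N \<Longrightarrow> y i < t i \<and> t i < y (Suc i) \<and> poly u (t i) = 0"
    by metis
  \<comment> \<open>\<open>r i\<close> is the sample point \<open>y (Suc i)\<close>, which separates
    the gaps of \<open>t i\<close> and \<open>t (Suc i)\<close>.\<close>
  have t_inter: "interlacing (Suc n) t r"
    unfolding interlacing_def using t y_Suc by (metis N_def Suc_less_eq less_Suc_eq less_Suc_eq_le)
  have "inj_on t {..<N}" unfolding N_def by (rule interlacing_mono(5)[OF t_inter])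
  then have "u = linear_prod N t" by (rule monic_eq_linear_prod[OF deg lc]) (use t in auto)
  then show ?thesis using t_inter unfolding N_def by blast
qed

section \<open>Negative roots of interlaced polynomials\<close>

definition interlaced :: "nat \<Rightarrow> real poly \<Rightarrow> real poly \<Rightarrow> bool" where
  "interlaced n p q \<longleftrightarrow> (\<exists>r s. p = linear_prod (Suc n) r \<and> q = linear_prod n s \<and>
     interlacing n r s)"

text \<open>Each root counts once, which agrees with the count by multiplicity for products of
  distinct linear factors.\<close>

definition neg_roots :: "real poly \<Rightarrow> real set" where
  "neg_roots p = {x. x < 0 \<and> poly p x = 0}"

lemma card_neg_roots_linear_prod:
  assumes "inj_on r {..<n}"
  shows "card (neg_roots (linear_prod n r)) = card {i. i < n \<and> r i < 0}"
proof -
  have "neg_roots (linear_prod n r) = r ` {i. i < n \<and> r i < 0}"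
    by (auto simp: neg_roots_def poly_linear_prod_eq_0_iff)
  then show ?thesis using assms by (auto intro!: card_image simp: inj_on_def)
qed

text \<open>Let \<open>q\<close> have \<open>k\<close> negative roots. Interlacing makes
  \<open>r i\<close> negative for \<open>i < k\<close> and positive for \<open>i > k\<close>, so
  only the sign of \<open>r k\<close> is open. It is negative exactly when \<open>p\<close> and
  \<open>q\<close> have equal signs at 0 or \<open>q\<close> vanishes there.\<close>

lemma card_neg_roots_interlaced:
  assumes "interlaced n p q" "\<not> (poly p 0 = 0 \<and> poly q 0 = 0)"
  shows "card (neg_roots p) =
    card (neg_roots q) + (if 0 < poly p 0 * poly q 0 \<or> poly q 0 = 0 then 1 else 0)"
proof -
  obtain r s where p: "p = linear_prod (Suc n) r" and q: "q = linear_prod n s"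
    and rs: "interlacing n r s" using assms(1) unfolding interlaced_def by blast
  note inter = interlacing_mono[OF rs]
  \<comment> \<open>This will be the number of negative \<open>s i\<close>. The alternative
    \<open>n \<le> k\<close> makes the minimum exist when all of them are negative.\<close>
  define k where "k = (LEAST k. n \<le> k \<or> 0 \<le> s k)"
  have k: "n \<le> k \<or> 0 \<le> s k" unfolding k_def by (rule LeastI[of _ n]) simp
  have below: "i < n \<and> s i < 0" if "i < k" for i
    using not_less_Least[of i "\<lambda>k. n \<le> k \<or> 0 \<le> s k"] that unfolding k_def by auto
  have kn: "k \<le> n" unfolding k_def by (rule Least_le) simp
  have s_above: "0 < s i" if "k < i" "i < n" for i
    using inter(2)[of k i] k that by force
  have r_below: "r i < 0" if "i < k" for i
    using inter(4)[of i i] below[OF that] by force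
  have r_above: "0 < r i" if "k < i" "i \<le> n" for i
    using inter(3)[of k i] k that by force
  have "{i. i < n \<and> s i < 0} = {..<k}"
    using below k s_above by (auto, metis less_le_not_le linorder_cases not_le)
  then have Nq: "card (neg_roots q) = k"
    unfolding q card_neg_roots_linear_prod[OF inter(6)] by simp
  have "{i. i < Suc n \<and> r i < 0} = (if r k < 0 then {..<Suc k} else {..<k})"
    using r_below kn r_above by (auto simp: less_Suc_eq_le le_less, (metis linorder_cases less_asym)+)
  then have Np: "card (neg_roots p) = k + (if r k < 0 then 1 else 0)"
    unfolding p card_neg_roots_linear_prod[OF inter(5)] by simp
  have q0: "poly q 0 = 0 \<longleftrightarrow> k < n \<and> s k = 0"
    unfolding q poly_linear_prod_eq_0_iff
    using below s_above by (metis less_irrefl linorder_cases)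
  have sgn_q: "0 < (-1) ^ (n - k) * poly q 0" if "poly q 0 \<noteq> 0"
    unfolding q
    by (rule sign_poly_linear_prod[OF kn])
      (use below s_above k that q0 in \<open>auto simp: le_less\<close>)
  have mult_sign: "0 < e * x \<Longrightarrow> 0 < e * y \<Longrightarrow> 0 < x * y" for e x y :: real
    by (auto simp: zero_less_mult_iff)
  consider "r k < 0" | "r k = 0" | "0 < r k" by linarith
  then show ?thesis
  proof cases
    case 1
    have "0 < (-1) ^ (Suc n - Suc k) * poly p 0"
      unfolding p
      by (rule sign_poly_linear_prod) (use kn r_below r_above 1 in \<open>auto simp: less_Suc_eq\<close>)
    then have "0 < poly p 0 * poly q 0 \<or> poly q 0 = 0"
      using sgn_q mult_sign[of "(-1) ^ (n - k)" "poly p 0" "poly q 0"] by auto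
    then show ?thesis using Np Nq 1 by simp
  next
    case 2
    then have "poly p 0 = 0"
      unfolding p poly_linear_prod_eq_0_iff using kn by (intro exI[of _ k]) auto
    \<comment> \<open>Both alternatives in the conditional fail: the product is 0, and
      \<open>q\<close> cannot vanish at 0 together with \<open>p\<close>.\<close>
    then show ?thesis using Np Nq 2 assms(2) by simp
  next
    case 3
    have "0 < (-1) ^ (Suc n - k) * poly p 0"
      unfolding p
    proof (rule sign_poly_linear_prod)
      show "0 < r j" if "k \<le> j" "j < Suc n" for j
        using r_above[of j] 3 that by (cases "j = k") auto
    qed (use kn r_below in auto)
    then have "0 < (-1) ^ (n - k) * (- poly p 0)" using kn by (simp add: Suc_diff_le)
    \<comment> \<open>If \<open>k < n\<close>, then \<open>s k\<close> exceeds \<open>r k\<close>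
      and is positive, so 0 is no root of \<open>q\<close>.\<close>
    moreover have q_nz: "poly q 0 \<noteq> 0" using q0 inter(4)[of k k] 3 by auto
    ultimately have "0 < - poly p 0 * poly q 0" using sgn_q by (blast intro: mult_sign)
    then show ?thesis using Np Nq 3 q_nz by simp
  qed
qed

section \<open>Characteristic polynomials of tridiagonal matrices\<close>

text \<open>A continuant expanded from the top left corner: shifting \<open>d\<close> passes to a
  trailing principal submatrix, just as the chain passes to its tail.\<close>

fun jacobi_poly :: "nat \<Rightarrow> (nat \<Rightarrow> real) \<Rightarrow> real poly" where
  "jacobi_poly 0 d = 1"
| "jacobi_poly (Suc 0) d = [:- d 0, 1:]"
| "jacobi_poly (Suc (Suc n)) d =
    [:- d 0, 1:] * jacobi_poly (Suc n) (\<lambda>i. d (Suc i)) - jacobi_poly n (\<lambda>i. d (Suc (Suc i)))"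

lemma interlaced_jacobi_poly:
  "interlaced n (jacobi_poly (Suc n) d) (jacobi_poly n (\<lambda>i. d (Suc i)))"
proof (induction n arbitrary: d)
  case 0
  have "jacobi_poly (Suc 0) d = linear_prod (Suc 0) d" "jacobi_poly 0 (\<lambda>i. d (Suc i)) = linear_prod 0 d"
    by (simp_all add: linear_prod_def)
  then show ?case unfolding interlaced_def interlacing_def by blast
next
  case (Suc n)
  obtain r s where "jacobi_poly (Suc n) (\<lambda>i. d (Suc i)) = linear_prod (Suc n) r"
    "jacobi_poly n (\<lambda>i. d (Suc (Suc i))) = linear_prod n s" "interlacing n r s"
    using Suc[of "\<lambda>i. d (Suc i)"] unfolding interlaced_def by blast
  then show ?case
    using interlacing_step[of n r s "d 0"] unfolding interlaced_def by auto
qed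

text \<open>This is \<open>X I - M\<close> for the tridiagonal \<open>M\<close> with diagonal
  \<open>d\<close> and off-diagonal entries 1.\<close>

definition tridiag_char_matrix :: "nat \<Rightarrow> (nat \<Rightarrow> real) \<Rightarrow> real poly mat" where
  "tridiag_char_matrix n d = mat n n (\<lambda>(i, j). if i = j then [:- d i, 1:]
     else if i = Suc j \<or> j = Suc i then -1 else 0)"

text \<open>Expansion along the first column leaves two terms. In the second, the minor
  \<open>?B\<close> has first row \<open>(-1, 0, ..., 0)\<close>, and the two off-diagonal entries
  multiply to 1.\<close>

lemma det_tridiag_char_matrix: "det (tridiag_char_matrix n d) = jacobi_poly n d"
proof (induction n d rule: jacobi_poly.induct)
  case (1 d)
  show ?case by (simp add: det_def tridiag_char_matrix_def)
next
  case (2 d)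
  show ?case by (subst det_single) (auto simp: tridiag_char_matrix_def)
next
  case (3 n d)
  let ?A = "tridiag_char_matrix (Suc (Suc n)) d"
  let ?B = "mat_delete ?A 1 0"
  have A: "?A \<in> carrier_mat (Suc (Suc n)) (Suc (Suc n))" by (simp add: tridiag_char_matrix_def)
  have B: "?B \<in> carrier_mat (Suc n) (Suc n)" using mat_delete_carrier[OF A] by simp
  have del_A: "mat_delete ?A 0 0 = tridiag_char_matrix (Suc n) (\<lambda>i. d (Suc i))"
    by (rule eq_matI) (auto simp: mat_delete_def tridiag_char_matrix_def)
  have del_B: "mat_delete ?B 0 0 = tridiag_char_matrix n (\<lambda>i. d (Suc (Suc i)))"
    by (rule eq_matI) (auto simp: mat_delete_def tridiag_char_matrix_def)
  have "det ?B = (\<Sum>j<Suc n. ?B $$ (0, j) * cofactor ?B 0 j)"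
    by (rule laplace_expansion_row[OF B]) simp
  also have "\<dots> = ?B $$ (0, 0) * cofactor ?B 0 0"
    unfolding sum.lessThan_Suc_shift
    by (simp add: mat_delete_def tridiag_char_matrix_def)
  also have "\<dots> = - jacobi_poly n (\<lambda>i. d (Suc (Suc i)))"
    unfolding cofactor_def del_B 3(2) by (simp add: mat_delete_def tridiag_char_matrix_def)
  finally have det_B: "det ?B = - jacobi_poly n (\<lambda>i. d (Suc (Suc i)))" .
  have "det ?A = (\<Sum>i<Suc (Suc n). ?A $$ (i, 0) * cofactor ?A i 0)"
    by (rule laplace_expansion_column[OF A]) simp
  also have "\<dots> = ?A $$ (0, 0) * cofactor ?A 0 0 + ?A $$ (1, 0) * cofactor ?A 1 0"
    unfolding sum.lessThan_Suc_shift by (simp add: tridiag_char_matrix_def)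
  also have "\<dots> = jacobi_poly (Suc (Suc n)) d"
    unfolding cofactor_def del_A 3(1) det_B by (simp add: tridiag_char_matrix_def)
  finally show ?case .
qed

lemma char_poly_sturm_matrix:
  "char_poly (sturm_matrix m D a) = jacobi_poly m (\<lambda>i. poly (D (i + 1)) a)"
proof -
  have "char_poly_matrix (sturm_matrix m D a) = tridiag_char_matrix m (\<lambda>i. poly (D (i + 1)) a)"
    by (rule eq_matI)
      (auto simp: char_poly_matrix_def sturm_matrix_def tridiag_char_matrix_def one_pCons)
  then show ?thesis by (simp add: char_poly_def det_tridiag_char_matrix)
qed

lemma jacobi_poly_linear_prod:
  obtains r where "jacobi_poly n d = linear_prod n r" "inj_on r {..<n}"
proof (cases n)
  case 0
  then show ?thesis using that[of d] by (simp add: linear_prod_def)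
next
  case (Suc k)
  then show ?thesis
    using interlaced_jacobi_poly[of k d] interlacing_mono(5) that unfolding interlaced_def by metis
qed

text \<open>The characteristic polynomial has distinct real roots, so each order in the sum is 1 and
  the sum is a cardinality.\<close>

lemma neg_index_sturm_matrix:
  "neg_index (sturm_matrix m D a) = card (neg_roots (jacobi_poly m (\<lambda>i. poly (D (i + 1)) a)))"
proof -
  let ?p = "jacobi_poly m (\<lambda>i. poly (D (i + 1)) a)"
  obtain r where r: "?p = linear_prod m r" "inj_on r {..<m}" by (rule jacobi_poly_linear_prod)
  have carrier: "sturm_matrix m D a \<in> carrier_mat m m" by (simp add: sturm_matrix_def)
  have "{k. eigenvalue (sturm_matrix m D a) k \<and> k < 0} = neg_roots ?p"
    unfolding eigenvalue_root_char_poly[OF carrier] char_poly_sturm_matrix neg_roots_def by auto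
  moreover have "order k ?p = 1" if "k \<in> neg_roots ?p" for k
    using that order_linear_prod[OF r(2)]
    unfolding neg_roots_def r(1) by (auto simp: poly_linear_prod_eq_0_iff)
  ultimately show ?thesis by (simp add: neg_index_def char_poly_sturm_matrix)
qed

section \<open>Sign variations along a three-term recurrence\<close>

lemma sign_variations_singleton: "sign_variations [x] = 0"
  by (simp add: sign_variations_def)

lemma sign_variations_0: "sign_variations (0 # xs) = sign_variations xs"
  by (simp add: sign_variations_def)

lemma sign_variations_Cons_0: "sign_variations (x # 0 # xs) = sign_variations (x # xs)"
  by (simp add: sign_variations_def)

text \<open>Index 0 compares \<open>x\<close> with \<open>y\<close>; the remaining indices are those
  for \<open>y # xs\<close> shifted by one.\<close>

lemma sign_variations_Cons:
  assumes "x \<noteq> 0" "y \<noteq> 0"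
  shows "sign_variations (x # y # xs) = (if x * y < 0 then 1 else 0) + sign_variations (y # xs)"
proof -
  define ds where "ds = y # filter (\<lambda>c. c \<noteq> 0) xs"
  define S where "S = {j. j + 1 < length ds \<and> ds ! j * ds ! (j + 1) < 0}"
  have "{j. j + 1 < length (x # ds) \<and> (x # ds) ! j * (x # ds) ! (j + 1) < 0} =
      (if x * y < 0 then {0} else {}) \<union> Suc ` S" (is "?L = ?R")
  proof (rule Set.set_eqI)
    fix j show "j \<in> ?L \<longleftrightarrow> j \<in> ?R" by (cases j) (auto simp: S_def ds_def)
  qed
  moreover have "finite S" unfolding S_def by (rule finite_subset[of _ "{..<length ds}"]) auto
  ultimately have "card {j. j + 1 < length (x # ds) \<and> (x # ds) ! j * (x # ds) ! (j + 1) < 0} =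
      (if x * y < 0 then 1 else 0) + card S"
    by (simp add: card_image)
  then show ?thesis using assms by (simp add: sign_variations_def S_def ds_def)
qed

text \<open>From \<open>v (Suc n) = 0\<close> and \<open>v n\<close> the recurrence determines
  \<open>v\<close> downwards. At 0 the factor \<open>X - d 0\<close> becomes \<open>- d 0\<close>,
  which the alternating sign absorbs.\<close>

lemma three_term_jacobi_poly:
  assumes "\<And>i. i < n \<Longrightarrow> v i = d i * v (Suc i) - v (Suc (Suc i))" "v (Suc n) = 0"
  shows "v 0 = (-1) ^ n * poly (jacobi_poly n d) 0 * v n"
  using assms
proof (induction n d arbitrary: v rule: jacobi_poly.induct)
  case (2 d)
  then show ?case using "2"(1)[of 0] by simp
next
  case (3 n d)
  have "v 1 = (-1) ^ Suc n * poly (jacobi_poly (Suc n) (\<lambda>i. d (Suc i))) 0 * v (Suc (Suc n))"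
    using 3(1)[of "\<lambda>i. v (Suc i)"] 3(3,4) by simp
  moreover have "v 2 = (-1) ^ n * poly (jacobi_poly n (\<lambda>i. d (Suc (Suc i)))) 0 * v (Suc (Suc n))"
    using 3(2)[of "\<lambda>i. v (Suc (Suc i))"] 3(3,4) by (simp add: numeral_2_eq_2)
  moreover have "v 0 = d 0 * v 1 - v 2" using 3(3)[of 0] by (simp add: numeral_2_eq_2)
  ultimately show ?case by (simp add: algebra_simps)
qed simp

text \<open>Read upwards, the recurrence gives each entry from the two before it, so two zeros at
  the start propagate.\<close>

lemma three_term_zero:
  fixes v d :: "nat \<Rightarrow> real"
  assumes "\<And>i. i < n \<Longrightarrow> v i = d i * v (Suc i) - v (Suc (Suc i))" "v 0 = 0" "v 1 = 0"
  shows "i \<le> n \<Longrightarrow> v i = 0 \<and> v (Suc i) = 0"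
proof (induction i)
  case (Suc i)
  then have "v i = 0" "v (Suc i) = 0" by simp_all
  with assms(1)[of i] Suc.prems show ?case by auto
qed (use assms in simp)

text \<open>By induction on the length: prepending \<open>v 0\<close> adds a variation exactly when
  the larger polynomial has one more negative root than its predecessor.\<close>

lemma sign_variations_three_term:
  assumes "\<And>i. i < n \<Longrightarrow> v i = d i * v (Suc i) - v (Suc (Suc i))" "v (Suc n) = 0" "v n \<noteq> 0"
  shows "sign_variations (map v [0..<Suc n]) = card (neg_roots (jacobi_poly n d))"
  using assms
proof (induction n d arbitrary: v rule: jacobi_poly.induct)
  case (1 d)
  then show ?case by (simp add: sign_variations_singleton neg_roots_def)
next
  case (2 d)
  have "v 0 = d 0 * v 1" using "2"(1)[of 0] "2"(2) by simp
  moreover have "neg_roots (jacobi_poly (Suc 0) d) = (if d 0 < 0 then {d 0} else {})"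
    by (auto simp: neg_roots_def)
  moreover have "d 0 * v 1 * v 1 < 0 \<longleftrightarrow> d 0 < 0"
    using "2"(3) by (simp add: mult.assoc mult_less_0_iff zero_less_mult_iff)
      (auto simp: not_less_iff_gr_or_eq)
  ultimately show ?case
    using "2"(3) by (cases "d 0 = 0")
      (simp_all add: sign_variations_0 sign_variations_singleton sign_variations_Cons)
next
  case (3 n d)
  let ?d1 = "\<lambda>i. d (Suc i)" and ?d2 = "\<lambda>i. d (Suc (Suc i))"
  define p q where "p = jacobi_poly (Suc (Suc n)) d" and "q = jacobi_poly (Suc n) ?d1"
  define xs where "xs = map (\<lambda>i. v (Suc (Suc (Suc i)))) [0..<n]"
  let ?c = "v (Suc (Suc n))"
  have unfold: "map v [0..<Suc (Suc (Suc n))] = v 0 # v 1 # v 2 # xs"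
    "map (\<lambda>i. v (Suc i)) [0..<Suc (Suc n)] = v 1 # v 2 # xs"
    "map (\<lambda>i. v (Suc (Suc i))) [0..<Suc n] = v 2 # xs"
    unfolding xs_def by (simp_all add: map_upt_Suc numeral_2_eq_2 del: upt_Suc)
  have IH1: "sign_variations (v 1 # v 2 # xs) = card (neg_roots q)"
    using 3(1)[of "\<lambda>i. v (Suc i)"] 3(3-5) unfolding unfold q_def by simp
  have v0: "v 0 = (-1) ^ Suc (Suc n) * poly p 0 * ?c"
    unfolding p_def by (rule three_term_jacobi_poly) (use 3(3,4) in auto)
  have v1: "v 1 = (-1) ^ Suc n * poly q 0 * ?c"
    using three_term_jacobi_poly[of "Suc n" "\<lambda>i. v (Suc i)" ?d1] 3(3,4) unfolding q_def by simp
  have v2: "v 2 = (-1) ^ n * poly (jacobi_poly n ?d2) 0 * ?c"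
    using three_term_jacobi_poly[of n "\<lambda>i. v (Suc (Suc i))" ?d2] 3(3,4)
    by (simp add: numeral_2_eq_2)
  have rec: "v 0 = d 0 * v 1 - v 2" using 3(3)[of 0] by (simp add: numeral_2_eq_2)
  \<comment> \<open>Two initial zeros would propagate up to \<open>?c\<close>, which is
    nonzero.\<close>
  have nz: "\<not> (v 0 = 0 \<and> v 1 = 0)"
    using three_term_zero[of "Suc (Suc n)" v d "Suc (Suc n)", OF 3(3)] 3(5) by blast
  have N: "card (neg_roots p) = card (neg_roots q) + (if v 0 * v 1 < 0 \<or> v 1 = 0 then 1 else 0)"
  proof -
    \<comment> \<open>The sign powers in \<open>v0\<close> and \<open>v1\<close> have opposite
      parity, so a variation between \<open>v 0\<close> and \<open>v 1\<close> means equal signs of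
      \<open>p\<close> and \<open>q\<close> at 0.\<close>
    have "v 0 * v 1 = - (poly p 0 * poly q 0) * ((-1) ^ n * ?c)\<^sup>2"
      unfolding v0 v1 by (simp add: power2_eq_square algebra_simps)
    moreover have "0 < ((-1) ^ n * ?c)\<^sup>2" using 3(5) by simp
    ultimately have "v 0 * v 1 < 0 \<longleftrightarrow> 0 < poly p 0 * poly q 0"
      by (simp add: mult_less_0_iff zero_less_mult_iff not_less_iff_gr_or_eq)
    moreover have "v 1 = 0 \<longleftrightarrow> poly q 0 = 0" "v 0 = 0 \<longleftrightarrow> poly p 0 = 0"
      using 3(5) unfolding v0 v1 by simp_all
    ultimately show ?thesis
      using card_neg_roots_interlaced[OF interlaced_jacobi_poly[of "Suc n" d]] nz
      unfolding p_def q_def by simp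
  qed
  show ?case
  proof (cases "v 1 = 0")
    case True
    \<comment> \<open>The neighbours of a zero entry are nonzero and opposite. Deleting the zero
      leaves one variation, matching the root gained when \<open>q\<close> vanishes at 0.\<close>
    then have "v 0 = - v 2" "v 2 \<noteq> 0" using rec nz by auto
    then have "sign_variations (v 0 # v 1 # v 2 # xs) = 1 + sign_variations (v 2 # xs)"
      unfolding True sign_variations_Cons_0
      by (subst sign_variations_Cons) (auto simp: mult_less_0_iff zero_less_mult_iff)
    then show ?thesis using IH1 N True unfolding unfold p_def by (simp add: sign_variations_0)
  next
    case False
    then show ?thesis
      using IH1 N unfolding unfold p_def
      by (cases "v 0 = 0") (simp_all add: sign_variations_0 sign_variations_Cons)
  qed
qed

theorem theorem1:
  fixes f g :: "real poly" and a :: real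
    and m :: nat and F D :: "nat \<Rightarrow> real poly"
  assumes "degree f > 0" and "degree g > 0"
    and "\<not> (poly f a = 0 \<and> poly g a = 0)"
    and "sturm_chain f g m F D"
  shows "neg_index (sturm_matrix m D a) = sturm_variations m F a"
proof -
  \<comment> \<open>The value 0 beyond \<open>m\<close> turns the final exact division
    \<open>F (m - 1) = D m * F m\<close> into an instance of the three-term recurrence.\<close>
  define v where "v i = (if i \<le> m then poly (F i) a else 0)" for i
  define d where "d i = poly (D (i + 1)) a" for i
  note ends = sturm_chain_ends[OF assms(4)]
  have rec: "v i = d i * v (Suc i) - v (Suc (Suc i))" if "i < m" for i
  proof (cases "Suc i = m")
    case True
    then have "F i = D m * F m" using ends(4) by auto
    then show ?thesis using True by (auto simp: v_def d_def)
  next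
    case False
    then have "F i = D (Suc i) * F (Suc i) - F (Suc (Suc i))"
      using sturm_chain_step(1)[OF assms(4), of "Suc i"] that by simp
    then show ?thesis using that False by (simp add: v_def d_def)
  qed
  have v_end: "v (Suc m) = 0" by (simp add: v_def)
  \<comment> \<open>Both \<open>v 0\<close> and \<open>v 1\<close> are multiples of
    \<open>v m\<close>, so \<open>v m = 0\<close> would make \<open>a\<close> a common root of
    \<open>f\<close> and \<open>g\<close>.\<close>
  have "v m \<noteq> 0"
  proof
    assume vm: "v m = 0"
    have "v 0 = 0" using three_term_jacobi_poly[OF rec v_end] vm by simp
    \<comment> \<open>The same formula applies to the tail starting at \<open>v 1\<close>, which
      reaches \<open>v m\<close> after \<open>m - 1\<close> steps.\<close>
    moreover have "v 1 = 0"
      using three_term_jacobi_poly[of "m - 1" "\<lambda>i. v (Suc i)" "\<lambda>i. d (Suc i)"] rec v_end vm ends(1)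
      by simp
    ultimately show False using assms(3) ends(1-3) by (simp add: v_def)
  qed
  then have "sign_variations (map v [0..<Suc m]) = card (neg_roots (jacobi_poly m d))"
    using sign_variations_three_term[OF rec v_end] by simp
  moreover have "map v [0..<Suc m] = map (\<lambda>i. poly (F i) a) [0..<m + 1]"
    by (simp add: v_def)
  ultimately show ?thesis
    unfolding neg_index_sturm_matrix sturm_variations_def d_def by (simp only:)
qed

end
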